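(* Let $\mathbb{C}_1,\dots,\mathbb{C}_n$ and $\mathbb{D}$ be comonads on categories $\mathcal{C}_1,\dots,\mathcal{C}_n$ and $\mathcal{D}$ respectively, and $H\colon\prod_i\mathcal{C}_i\to\mathcal{D}$ a functor. If there exists a Kleisli law of type $\mathbb{D}\circ H\Rightarrow H\circ\prod_i\mathbb{C}_i$, then for all objects $A_i,B_i\in\mathcal{C}_i$: if $A_i\cong_{\mathbb{C}_i}B_i$ for every $i=1,\dots,n$, then $H(A_1,\dots,A_n)\cong_{\mathbb{D}}H(B_1,\dots,B_n)$.
   Context: Comonads $(\mathbb{C},\varepsilon,\delta)$ have counit $\varepsilon$ and comultiplication $\delta$. The Kleisli category of $\mathbb{C}$ has the objects of $\mathcal{C}$, morphisms $A\to B$ are morphisms $\mathbb{C}(A)\to B$ of $\mathcal{C}$, identities are $\varepsilon_A$, and the composite of $f\colon\mathbb{C}(A)\to B$ and $g\colon\mathbb{C}(B)\to C$ is $g\circ f^*$ where $f^*=\mathbb{C}(f)\circ\delta_A$. Write $A\cong_{\mathbb{C}}B$ if $A$ and $B$ are isomorphic in the Kleisli category of $\mathbb{C}$. A Kleisli law of type $\mathbb{D}\circ H\Rightarrow H\circ\prod_i\mathbb{C}_i$ is a natural transformation $\kappa$ with components $\kappa_{\vec A}\colon\mathbb{D}H(A_1,\dots,A_n)\to H(\mathbb{C}_1A_1,\dots,\mathbb{C}_nA_n)$ such that $H(\varepsilon_{A_1},\dots,\varepsilon_{A_n})\circ\kappa_{\vec A}=\varepsilon_{H(\vec A)}$ and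 $\kappa_{\mathbb{C}_1A_1,\dots,\mathbb{C}_nA_n}\circ\mathbb{D}(\kappa_{\vec A})\circ\delta_{H(\vec A)}=H(\delta_{A_1},\dots,\delta_{A_n})\circ\kappa_{\vec A}$. *)

theory Defs
  imports "HOL-Library.FuncSet"
begin

section \<open>Categories, functors, natural transformations\<close>

record ('o, 'm) category =
  Ob :: "'o set"
  Ar :: "'m set"
  Dom :: "'m \<Rightarrow> 'o"
  Cod :: "'m \<Rightarrow> 'o"
  Id :: "'o \<Rightarrow> 'm"
  Comp :: "'m \<Rightarrow> 'm \<Rightarrow> 'm"  (infixl \<open>\<cdot>\<index>\<close> 70)

definition Hom :: "('o, 'm) category \<Rightarrow> 'o \<Rightarrow> 'o \<Rightarrow> 'm set" where
  "Hom C A B = {f \<in> Ar C. Dom C f = A \<and> Cod C f = B}"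

locale category =
  fixes C :: "('o, 'm) category" (structure)
  assumes Dom_in_Ob: "f \<in> Ar C \<Longrightarrow> Dom C f \<in> Ob C"
    and Cod_in_Ob: "f \<in> Ar C \<Longrightarrow> Cod C f \<in> Ob C"
    and Id_in_Hom: "A \<in> Ob C \<Longrightarrow> Id C A \<in> Hom C A A"
    and Comp_in_Hom: "\<lbrakk>f \<in> Hom C X Y; g \<in> Hom C Y Z\<rbrakk> \<Longrightarrow> g \<cdot> f \<in> Hom C X Z"
    and Comp_Id: "f \<in> Hom C X Y \<Longrightarrow> f \<cdot> Id C X = f"
    and Id_Comp: "f \<in> Hom C X Y \<Longrightarrow> Id C Y \<cdot> f = f"
    and Comp_assoc: "\<lbrakk>f \<in> Hom C W X; g \<in> Hom C X Y; h \<in> Hom C Y Z\<rbrakk>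
          \<Longrightarrow> (h \<cdot> g) \<cdot> f = h \<cdot> (g \<cdot> f)"

definition isomorphic :: "('o, 'm) category \<Rightarrow> 'o \<Rightarrow> 'o \<Rightarrow> bool" where
  "isomorphic C A B \<longleftrightarrow> A \<in> Ob C \<and> B \<in> Ob C \<and>
     (\<exists>f \<in> Hom C A B. \<exists>g \<in> Hom C B A. g \<cdot>\<^bsub>C\<^esub> f = Id C A \<and> f \<cdot>\<^bsub>C\<^esub> g = Id C B)"

record ('o, 'm, 'p, 'q) cat_functor =
  ObMap :: "'o \<Rightarrow> 'p"
  ArMap :: "'m \<Rightarrow> 'q"

locale cat_functor = C: category C + D: category D
  for C :: "('o, 'm) category" and D :: "('p, 'q) category" +
  fixes F :: "('o, 'm, 'p, 'q) cat_functor"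
  assumes ObMap_in_Ob: "A \<in> Ob C \<Longrightarrow> ObMap F A \<in> Ob D"
    and ArMap_in_Hom: "f \<in> Hom C X Y \<Longrightarrow> ArMap F f \<in> Hom D (ObMap F X) (ObMap F Y)"
    and ArMap_Id: "A \<in> Ob C \<Longrightarrow> ArMap F (Id C A) = Id D (ObMap F A)"
    and ArMap_Comp: "\<lbrakk>f \<in> Hom C X Y; g \<in> Hom C Y Z\<rbrakk>
          \<Longrightarrow> ArMap F (g \<cdot>\<^bsub>C\<^esub> f) = ArMap F g \<cdot>\<^bsub>D\<^esub> ArMap F f"

definition id_functor :: "('o, 'm, 'o, 'm) cat_functor" where
  "id_functor = \<lparr>ObMap = (\<lambda>A. A), ArMap = (\<lambda>f. f)\<rparr>"

definition comp_functor ::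
    "('p, 'q, 'r, 's) cat_functor \<Rightarrow> ('o, 'm, 'p, 'q) cat_functor \<Rightarrow> ('o, 'm, 'r, 's) cat_functor"
    (infixl \<open>\<circ>\<^sub>F\<close> 55) where
  "G \<circ>\<^sub>F F = \<lparr>ObMap = (\<lambda>A. ObMap G (ObMap F A)), ArMap = (\<lambda>f. ArMap G (ArMap F f))\<rparr>"

locale nat_trans = F: cat_functor C D F + G: cat_functor C D G
  for C :: "('o, 'm) category" and D :: "('p, 'q) category"
    and F G :: "('o, 'm, 'p, 'q) cat_functor" +
  fixes \<tau> :: "'o \<Rightarrow> 'q"
  assumes component_in_Hom: "A \<in> Ob C \<Longrightarrow> \<tau> A \<in> Hom D (ObMap F A) (ObMap G A)"
    and naturality: "f \<in> Hom C X Y \<Longrightarrow> \<tau> Y \<cdot>\<^bsub>D\<^esub> ArMap F f = ArMap G f \<cdot>\<^bsub>D\<^esub> \<tau> X"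


section \<open>Products of categories\<close>

text \<open>
  Tuples are functions on the index set \<open>I\<close>, made unique by being \<open>undefined\<close> outside \<open>I\<close>.
  The factors share the carrier types but have arbitrary carrier sets, so that distinct
  categories can be accommodated.
\<close>

definition prod_category :: "'i set \<Rightarrow> ('i \<Rightarrow> ('o, 'm) category) \<Rightarrow> ('i \<Rightarrow> 'o, 'i \<Rightarrow> 'm) category" where
  "prod_category I C =
    \<lparr>Ob = (\<Pi>\<^sub>E i\<in>I. Ob (C i)),
     Ar = (\<Pi>\<^sub>E i\<in>I. Ar (C i)),
     Dom = (\<lambda>f. \<lambda>i\<in>I. Dom (C i) (f i)),
     Cod = (\<lambda>f. \<lambda>i\<in>I. Cod (C i) (f i)),
     Id = (\<lambda>A. \<lambda>i\<in>I. Id (C i) (A i)),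
     Comp = (\<lambda>g f. \<lambda>i\<in>I. g i \<cdot>\<^bsub>C i\<^esub> f i)\<rparr>"

definition prod_functor ::
    "'i set \<Rightarrow> ('i \<Rightarrow> ('o, 'm, 'p, 'q) cat_functor) \<Rightarrow> ('i \<Rightarrow> 'o, 'i \<Rightarrow> 'm, 'i \<Rightarrow> 'p, 'i \<Rightarrow> 'q) cat_functor"
  where
  "prod_functor I F =
    \<lparr>ObMap = (\<lambda>A. \<lambda>i\<in>I. ObMap (F i) (A i)),
     ArMap = (\<lambda>f. \<lambda>i\<in>I. ArMap (F i) (f i))\<rparr>"


section \<open>Comonads and their Kleisli categories\<close>

record ('o, 'm) comonad =
  Fun :: "('o, 'm, 'o, 'm) cat_functor"
  counit :: "'o \<Rightarrow> 'm"  (\<open>\<epsilon>\<index>\<close>)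
  comult :: "'o \<Rightarrow> 'm"  (\<open>\<delta>\<index>\<close>)

locale comonad =
  T: cat_functor C C "Fun T" +
  counit: nat_trans C C "Fun T" id_functor "counit T" +
  comult: nat_trans C C "Fun T" "Fun T \<circ>\<^sub>F Fun T" "comult T"
  for C :: "('o, 'm) category" and T :: "('o, 'm) comonad" +
  assumes counit_comult:
      "A \<in> Ob C \<Longrightarrow> \<epsilon>\<^bsub>T\<^esub> (ObMap (Fun T) A) \<cdot>\<^bsub>C\<^esub> \<delta>\<^bsub>T\<^esub> A = Id C (ObMap (Fun T) A)"
    and map_counit_comult:
      "A \<in> Ob C \<Longrightarrow> ArMap (Fun T) (\<epsilon>\<^bsub>T\<^esub> A) \<cdot>\<^bsub>C\<^esub> \<delta>\<^bsub>T\<^esub> A = Id C (ObMap (Fun T) A)"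
    and comult_comult:
      "A \<in> Ob C \<Longrightarrow> \<delta>\<^bsub>T\<^esub> (ObMap (Fun T) A) \<cdot>\<^bsub>C\<^esub> \<delta>\<^bsub>T\<^esub> A = ArMap (Fun T) (\<delta>\<^bsub>T\<^esub> A) \<cdot>\<^bsub>C\<^esub> \<delta>\<^bsub>T\<^esub> A"

definition coextend :: "('o, 'm) category \<Rightarrow> ('o, 'm) comonad \<Rightarrow> 'o \<Rightarrow> 'm \<Rightarrow> 'm" where
  "coextend C T A f = ArMap (Fun T) f \<cdot>\<^bsub>C\<^esub> \<delta>\<^bsub>T\<^esub> A"

text \<open>
  A Kleisli arrow is tagged with its source, since \<open>A\<close> cannot be recovered from an arrow with
  domain \<open>T A\<close> when \<open>T\<close> is not injective on objects.
\<close>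

definition kleisli_category :: "('o, 'm) category \<Rightarrow> ('o, 'm) comonad \<Rightarrow> ('o, 'o \<times> 'm) category" where
  "kleisli_category C T =
    \<lparr>Ob = Ob C,
     Ar = {(A, f). A \<in> Ob C \<and> f \<in> Ar C \<and> Dom C f = ObMap (Fun T) A},
     Dom = (\<lambda>(A, f). A),
     Cod = (\<lambda>(A, f). Cod C f),
     Id = (\<lambda>A. (A, \<epsilon>\<^bsub>T\<^esub> A)),
     Comp = (\<lambda>(B, g) (A, f). (A, g \<cdot>\<^bsub>C\<^esub> coextend C T A f))\<rparr>"

definition kleisli_isomorphic :: "('o, 'm) category \<Rightarrow> ('o, 'm) comonad \<Rightarrow> 'o \<Rightarrow> 'o \<Rightarrow> bool" where
  "kleisli_isomorphic C T A B \<longleftrightarrow> isomorphic (kleisli_category C T) A B"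


section \<open>Kleisli laws\<close>

locale kleisli_law =
  nat_trans "prod_category I C" D "Fun S \<circ>\<^sub>F H" "H \<circ>\<^sub>F prod_functor I (\<lambda>i. Fun (T i))" \<kappa>
  for I :: "'i set" and C :: "'i \<Rightarrow> ('o, 'm) category" and T :: "'i \<Rightarrow> ('o, 'm) comonad"
    and D :: "('p, 'q) category" and S :: "('p, 'q) comonad"
    and H :: "('i \<Rightarrow> 'o, 'i \<Rightarrow> 'm, 'p, 'q) cat_functor" and \<kappa> :: "('i \<Rightarrow> 'o) \<Rightarrow> 'q" +
  assumes law_counit: "A \<in> Ob (prod_category I C) \<Longrightarrow>
      ArMap H (\<lambda>i\<in>I. \<epsilon>\<^bsub>T i\<^esub> (A i)) \<cdot>\<^bsub>D\<^esub> \<kappa> A = \<epsilon>\<^bsub>S\<^esub> (ObMap H A)"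
    and law_comult: "A \<in> Ob (prod_category I C) \<Longrightarrow>
      \<kappa> (\<lambda>i\<in>I. ObMap (Fun (T i)) (A i)) \<cdot>\<^bsub>D\<^esub> ArMap (Fun S) (\<kappa> A) \<cdot>\<^bsub>D\<^esub> \<delta>\<^bsub>S\<^esub> (ObMap H A)
        = ArMap H (\<lambda>i\<in>I. \<delta>\<^bsub>T i\<^esub> (A i)) \<cdot>\<^bsub>D\<^esub> \<kappa> A"


section \<open>Well-definedness of the constructions\<close>

lemma Hom_prod_category:
  "f \<in> Hom (prod_category I C) A B \<longleftrightarrow>
     A \<in> extensional I \<and> B \<in> extensional I \<and> f \<in> (\<Pi>\<^sub>E i\<in>I. Hom (C i) (A i) (B i))"
  (is "?l \<longleftrightarrow> ?r")
proof
  assume ?l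
  then show ?r
    unfolding Hom_def prod_category_def by (auto simp: PiE_iff)
next
  assume r: ?r
  then have "(\<lambda>i\<in>I. Dom (C i) (f i)) = A" "(\<lambda>i\<in>I. Cod (C i) (f i)) = B"
    by (auto simp: Hom_def PiE_iff extensional_def)
  with r show ?l
    unfolding Hom_def prod_category_def by (auto simp: PiE_iff)
qed

lemma prod_category_simps:
  "Ob (prod_category I C) = (\<Pi>\<^sub>E i\<in>I. Ob (C i))"
  "Ar (prod_category I C) = (\<Pi>\<^sub>E i\<in>I. Ar (C i))"
  "Dom (prod_category I C) f = (\<lambda>i\<in>I. Dom (C i) (f i))"
  "Cod (prod_category I C) f = (\<lambda>i\<in>I. Cod (C i) (f i))"
  "Id (prod_category I C) A = (\<lambda>i\<in>I. Id (C i) (A i))"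
  "g \<cdot>\<^bsub>prod_category I C\<^esub> f = (\<lambda>i\<in>I. g i \<cdot>\<^bsub>C i\<^esub> f i)"
  by (simp_all add: prod_category_def)

lemma category_prod_category:
  assumes "\<And>i. i \<in> I \<Longrightarrow> category (C i)"
  shows "category (prod_category I C)"
proof
  show "Dom (prod_category I C) f \<in> Ob (prod_category I C)"
    if "f \<in> Ar (prod_category I C)" for f
    using that category.Dom_in_Ob[OF assms] by (simp add: prod_category_simps PiE_iff)
  show "Cod (prod_category I C) f \<in> Ob (prod_category I C)"
    if "f \<in> Ar (prod_category I C)" for f
    using that category.Cod_in_Ob[OF assms] by (simp add: prod_category_simps PiE_iff)
  show "Id (prod_category I C) A \<in> Hom (prod_category I C) A A"
    if "A \<in> Ob (prod_category I C)" for A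
    using that category.Id_in_Hom[OF assms]
    by (simp add: Hom_prod_category prod_category_simps PiE_iff)
  show "g \<cdot>\<^bsub>prod_category I C\<^esub> f \<in> Hom (prod_category I C) X Z"
    if "f \<in> Hom (prod_category I C) X Y" "g \<in> Hom (prod_category I C) Y Z" for f g X Y Z
    using that category.Comp_in_Hom[OF assms]
    by (simp add: Hom_prod_category prod_category_simps PiE_iff) blast
  show "f \<cdot>\<^bsub>prod_category I C\<^esub> Id (prod_category I C) X = f"
    if "f \<in> Hom (prod_category I C) X Y" for f X Y
    using that category.Comp_Id[OF assms]
    by (intro extensionalityI[of _ I]) (auto simp: Hom_prod_category prod_category_simps PiE_iff)
  show "Id (prod_category I C) Y \<cdot>\<^bsub>prod_category I C\<^esub> f = f"
    if "f \<in> Hom (prod_category I C) X Y" for f X Y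
    using that category.Id_Comp[OF assms]
    by (intro extensionalityI[of _ I]) (auto simp: Hom_prod_category prod_category_simps PiE_iff)
  show "h \<cdot>\<^bsub>prod_category I C\<^esub> g \<cdot>\<^bsub>prod_category I C\<^esub> f
      = h \<cdot>\<^bsub>prod_category I C\<^esub> (g \<cdot>\<^bsub>prod_category I C\<^esub> f)"
    if "f \<in> Hom (prod_category I C) W X" "g \<in> Hom (prod_category I C) X Y"
      "h \<in> Hom (prod_category I C) Y Z" for f g h W X Y Z
    using that
    by (auto simp: Hom_prod_category prod_category_simps PiE_iff
        intro!: restrict_ext category.Comp_assoc[OF assms])
qed

lemma cat_functor_comp_functor:
  assumes "cat_functor B C F" "cat_functor C D G"
  shows "cat_functor B D (G \<circ>\<^sub>F F)"
proof -
  interpret F: cat_functor B C F by fact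
  interpret G: cat_functor C D G by fact
  show ?thesis
    by unfold_locales
      (auto simp: comp_functor_def F.ObMap_in_Ob F.ArMap_Id G.ArMap_Id F.ArMap_Comp
          G.ArMap_Comp[OF F.ArMap_in_Hom F.ArMap_in_Hom]
        intro: F.ObMap_in_Ob G.ObMap_in_Ob F.ArMap_in_Hom G.ArMap_in_Hom)
qed

lemma cat_functor_prod_functor:
  assumes "\<And>i. i \<in> I \<Longrightarrow> cat_functor (C i) (D i) (F i)"
  shows "cat_functor (prod_category I C) (prod_category I D) (prod_functor I F)"
proof -
  have C: "category (C i)" and D: "category (D i)" if "i \<in> I" for i
    using assms[OF that] by (simp_all add: cat_functor_def)
  interpret C: category "prod_category I C" by (rule category_prod_category[OF C])
  interpret D: category "prod_category I D" by (rule category_prod_category[OF D])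
  show ?thesis
    by unfold_locales
      (auto simp: prod_functor_def Hom_prod_category prod_category_simps PiE_iff
        intro!: restrict_ext cat_functor.ObMap_in_Ob[OF assms] cat_functor.ArMap_in_Hom[OF assms]
          cat_functor.ArMap_Id[OF assms] cat_functor.ArMap_Comp[OF assms])
qed

lemma Hom_kleisli_category:
  "p \<in> Hom (kleisli_category C T) A B \<longleftrightarrow>
     (\<exists>f. p = (A, f) \<and> A \<in> Ob C \<and> f \<in> Hom C (ObMap (Fun T) A) B)"
  unfolding Hom_def kleisli_category_def by auto

lemma kleisli_category_simps:
  "Ob (kleisli_category C T) = Ob C"
  "Id (kleisli_category C T) A = (A, \<epsilon>\<^bsub>T\<^esub> A)"
  "(B, g) \<cdot>\<^bsub>kleisli_category C T\<^esub> (A, f) = (A, g \<cdot>\<^bsub>C\<^esub> (ArMap (Fun T) f \<cdot>\<^bsub>C\<^esub> \<delta>\<^bsub>T\<^esub> A))"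
  by (simp_all add: kleisli_category_def coextend_def)

context comonad
begin

lemma counit_in_Hom: "A \<in> Ob C \<Longrightarrow> \<epsilon>\<^bsub>T\<^esub> A \<in> Hom C (ObMap (Fun T) A) A"
  using counit.component_in_Hom[of A] by (simp add: id_functor_def)

lemma comult_in_Hom:
  "A \<in> Ob C \<Longrightarrow> \<delta>\<^bsub>T\<^esub> A \<in> Hom C (ObMap (Fun T) A) (ObMap (Fun T) (ObMap (Fun T) A))"
  using comult.component_in_Hom[of A] by (simp add: comp_functor_def)

lemma coextend_in_Hom:
  assumes "A \<in> Ob C" "f \<in> Hom C (ObMap (Fun T) A) B"
  shows "coextend C T A f \<in> Hom C (ObMap (Fun T) A) (ObMap (Fun T) B)"
  using assms unfolding coextend_def
  by (blast intro: T.C.Comp_in_Hom comult_in_Hom T.ArMap_in_Hom)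

lemma coextend_counit: "A \<in> Ob C \<Longrightarrow> coextend C T A (\<epsilon>\<^bsub>T\<^esub> A) = Id C (ObMap (Fun T) A)"
  by (simp add: coextend_def map_counit_comult)

lemma counit_coextend:
  assumes A: "A \<in> Ob C" and f: "f \<in> Hom C (ObMap (Fun T) A) B"
  shows "\<epsilon>\<^bsub>T\<^esub> B \<cdot>\<^bsub>C\<^esub> coextend C T A f = f"
proof -
  have B: "B \<in> Ob C" using f T.C.Cod_in_Ob by (auto simp: Hom_def)
  have "\<epsilon>\<^bsub>T\<^esub> B \<cdot>\<^bsub>C\<^esub> coextend C T A f = (\<epsilon>\<^bsub>T\<^esub> B \<cdot>\<^bsub>C\<^esub> ArMap (Fun T) f) \<cdot>\<^bsub>C\<^esub> \<delta>\<^bsub>T\<^esub> A"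
    unfolding coextend_def
    by (rule T.C.Comp_assoc[symmetric, OF comult_in_Hom[OF A] T.ArMap_in_Hom[OF f] counit_in_Hom[OF B]])
  also have "\<dots> = (f \<cdot>\<^bsub>C\<^esub> \<epsilon>\<^bsub>T\<^esub> (ObMap (Fun T) A)) \<cdot>\<^bsub>C\<^esub> \<delta>\<^bsub>T\<^esub> A"
    using counit.naturality[OF f] by (simp add: id_functor_def)
  also have "\<dots> = f \<cdot>\<^bsub>C\<^esub> (\<epsilon>\<^bsub>T\<^esub> (ObMap (Fun T) A) \<cdot>\<^bsub>C\<^esub> \<delta>\<^bsub>T\<^esub> A)"
    by (rule T.C.Comp_assoc[OF comult_in_Hom[OF A] counit_in_Hom[OF T.ObMap_in_Ob[OF A]] f])
  also have "\<dots> = f"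
    using A f by (simp add: counit_comult T.C.Comp_Id)
  finally show ?thesis .
qed

lemma coextend_coextend:
  assumes A: "A \<in> Ob C" and f: "f \<in> Hom C (ObMap (Fun T) A) B"
    and g: "g \<in> Hom C (ObMap (Fun T) B) E"
  shows "coextend C T A (g \<cdot>\<^bsub>C\<^esub> coextend C T A f) = coextend C T B g \<cdot>\<^bsub>C\<^esub> coextend C T A f"
proof -
  let ?T = "ObMap (Fun T)" and ?M = "ArMap (Fun T)"
  have B: "B \<in> Ob C" using f T.C.Cod_in_Ob by (auto simp: Hom_def)
  note dA = comult_in_Hom[OF A] and dB = comult_in_Hom[OF B]
  note Tf = T.ArMap_in_Hom[OF f] and Tg = T.ArMap_in_Hom[OF g]
  note TTf = T.ArMap_in_Hom[OF Tf] and TdA = T.ArMap_in_Hom[OF dA]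
  note dTA = comult_in_Hom[OF T.ObMap_in_Ob[OF A]]
  have nat: "\<delta>\<^bsub>T\<^esub> B \<cdot>\<^bsub>C\<^esub> ?M f = ?M (?M f) \<cdot>\<^bsub>C\<^esub> \<delta>\<^bsub>T\<^esub> (?T A)"
    using comult.naturality[OF f] by (simp add: comp_functor_def)
  have "coextend C T A (g \<cdot>\<^bsub>C\<^esub> coextend C T A f)
      = (?M g \<cdot>\<^bsub>C\<^esub> (?M (?M f) \<cdot>\<^bsub>C\<^esub> ?M (\<delta>\<^bsub>T\<^esub> A))) \<cdot>\<^bsub>C\<^esub> \<delta>\<^bsub>T\<^esub> A"
    using T.ArMap_Comp[OF coextend_in_Hom[OF A f] g] T.ArMap_Comp[OF dA Tf]
    by (simp add: coextend_def)
  also have "\<dots> = ?M g \<cdot>\<^bsub>C\<^esub> (?M (?M f) \<cdot>\<^bsub>C\<^esub> (?M (\<delta>\<^bsub>T\<^esub> A) \<cdot>\<^bsub>C\<^esub> \<delta>\<^bsub>T\<^esub> A))"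
    using T.C.Comp_assoc[OF dA T.C.Comp_in_Hom[OF TdA TTf] Tg] T.C.Comp_assoc[OF dA TdA TTf] by simp
  also have "\<dots> = ?M g \<cdot>\<^bsub>C\<^esub> (\<delta>\<^bsub>T\<^esub> B \<cdot>\<^bsub>C\<^esub> (?M f \<cdot>\<^bsub>C\<^esub> \<delta>\<^bsub>T\<^esub> A))"
    using T.C.Comp_assoc[OF dA dTA TTf] T.C.Comp_assoc[OF dA Tf dB]
    by (simp add: comult_comult[OF A, symmetric] nat)
  also have "\<dots> = coextend C T B g \<cdot>\<^bsub>C\<^esub> coextend C T A f"
    using T.C.Comp_assoc[OF T.C.Comp_in_Hom[OF dA Tf] dB Tg] by (simp add: coextend_def)
  finally show ?thesis .
qed

lemma category_kleisli_category: "category (kleisli_category C T)"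
proof
  fix p assume "p \<in> Ar (kleisli_category C T)"
  then show "Dom (kleisli_category C T) p \<in> Ob (kleisli_category C T)"
    and "Cod (kleisli_category C T) p \<in> Ob (kleisli_category C T)"
    using T.C.Cod_in_Ob by (auto simp: kleisli_category_def)
next
  fix A assume "A \<in> Ob (kleisli_category C T)"
  then show "Id (kleisli_category C T) A \<in> Hom (kleisli_category C T) A A"
    by (simp add: Hom_kleisli_category kleisli_category_simps counit_in_Hom)
next
  fix p q X Y Z
  assume "p \<in> Hom (kleisli_category C T) X Y" "q \<in> Hom (kleisli_category C T) Y Z"
  then show "q \<cdot>\<^bsub>kleisli_category C T\<^esub> p \<in> Hom (kleisli_category C T) X Z"
    using T.C.Comp_in_Hom[OF coextend_in_Hom]
    by (auto simp: Hom_kleisli_category kleisli_category_simps coextend_def)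
next
  fix p X Y assume "p \<in> Hom (kleisli_category C T) X Y"
  then show "p \<cdot>\<^bsub>kleisli_category C T\<^esub> Id (kleisli_category C T) X = p"
    and "Id (kleisli_category C T) Y \<cdot>\<^bsub>kleisli_category C T\<^esub> p = p"
    using counit_coextend T.C.Comp_Id
    by (auto simp: Hom_kleisli_category kleisli_category_simps map_counit_comult coextend_def)
next
  fix p q r W X Y Z
  assume "p \<in> Hom (kleisli_category C T) W X" "q \<in> Hom (kleisli_category C T) X Y"
    "r \<in> Hom (kleisli_category C T) Y Z"
  then obtain f g h where p: "p = (W, f)" "q = (X, g)" "r = (Y, h)"
    and W: "W \<in> Ob C" and X: "X \<in> Ob C" and f: "f \<in> Hom C (ObMap (Fun T) W) X"
    and g: "g \<in> Hom C (ObMap (Fun T) X) Y" and h: "h \<in> Hom C (ObMap (Fun T) Y) Z"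
    by (auto simp: Hom_kleisli_category)
  show "r \<cdot>\<^bsub>kleisli_category C T\<^esub> q \<cdot>\<^bsub>kleisli_category C T\<^esub> p
      = r \<cdot>\<^bsub>kleisli_category C T\<^esub> (q \<cdot>\<^bsub>kleisli_category C T\<^esub> p)"
    using T.C.Comp_assoc[OF coextend_in_Hom[OF W f] coextend_in_Hom[OF X g] h]
      coextend_coextend[OF W f g]
    by (simp add: p kleisli_category_simps coextend_def)
qed

end

end

(*
  A Kleisli law \<kappa> turns a tuple of Kleisli arrows f_i : T_i A_i \<rightarrow> B_i into the Kleisli arrow
  H f \<cdot> \<kappa>_A : S (H A) \<rightarrow> H B. The counit axiom of \<kappa> says that this assignment preserves identities;
  the comultiplication axiom, together with naturality of \<kappa>, says that it preserves composites.
  So H extends to a functor of Kleisli categories, and functors preserve isomorphisms.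
*)
theory Submission imports Defs begin

text \<open>\<open>kleisli_law\<close> by itself yields functoriality of the two composites only, so
  functoriality of \<open>H\<close> and the comonad structures are added here. The family
  \<open>T\<close> is constrained only on \<open>I\<close>.\<close>

locale comonads_kleisli_law =
  kleisli_law I C T D S H \<kappa> + H: cat_functor "prod_category I C" D H + S: comonad D S
  for I :: "'i set" and C :: "'i \<Rightarrow> ('o, 'm) category" and T :: "'i \<Rightarrow> ('o, 'm) comonad"
    and D :: "('p, 'q) category" and S :: "('p, 'q) comonad"
    and H :: "('i \<Rightarrow> 'o, 'i \<Rightarrow> 'm, 'p, 'q) cat_functor" and \<kappa> :: "('i \<Rightarrow> 'o) \<Rightarrow> 'q" +
  assumes comonad_T: "i \<in> I \<Longrightarrow> comonad (C i) (T i)"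
begin

abbreviation "P \<equiv> prod_category I C"
abbreviation "PT \<equiv> prod_functor I (\<lambda>i. Fun (T i))"

text \<open>Arrow part of the functor between Kleisli categories induced by \<open>H\<close> and
  \<kappa>. The source \<open>A\<close> is an argument because \<open>f\<close> alone determines
  only \<open>ObMap PT A\<close>.\<close>

definition lift :: "('i \<Rightarrow> 'o) \<Rightarrow> ('i \<Rightarrow> 'm) \<Rightarrow> 'q" where
  "lift A f = ArMap H f \<cdot>\<^bsub>D\<^esub> \<kappa> A"

lemma cat_functor_PT: "cat_functor P P PT"
  using comonad_T by (intro cat_functor_prod_functor) (simp add: comonad_def)

sublocale PT: cat_functor P P PT
  by (rule cat_functor_PT)

lemma law_in_Hom: "A \<in> Ob P \<Longrightarrow> \<kappa> A \<in> Hom D (ObMap (Fun S) (ObMap H A)) (ObMap H (ObMap PT A))"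
  using component_in_Hom[of A] by (simp add: comp_functor_def)

lemma law_naturality:
  "f \<in> Hom P X Y \<Longrightarrow> \<kappa> Y \<cdot>\<^bsub>D\<^esub> ArMap (Fun S) (ArMap H f) = ArMap H (ArMap PT f) \<cdot>\<^bsub>D\<^esub> \<kappa> X"
  using naturality[of f X Y] by (simp add: comp_functor_def)

text \<open>\<open>PT\<close> underlies the product comonad on \<open>P\<close>, and this tuple is
  its comultiplication.\<close>

lemma comult_tuple_in_Hom:
  assumes "A \<in> Ob P"
  shows "(\<lambda>i\<in>I. \<delta>\<^bsub>T i\<^esub> (A i)) \<in> Hom P (ObMap PT A) (ObMap PT (ObMap PT A))"
  using assms comonad.comult_in_Hom[OF comonad_T]
  by (auto simp: Hom_prod_category prod_category_simps prod_functor_def PiE_iff)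

lemma lift_in_Hom:
  assumes "A \<in> Ob P" "f \<in> Hom P (ObMap PT A) B"
  shows "lift A f \<in> Hom D (ObMap (Fun S) (ObMap H A)) (ObMap H B)"
  using assms unfolding lift_def by (blast intro: F.D.Comp_in_Hom law_in_Hom H.ArMap_in_Hom)

lemma lift_counit: "A \<in> Ob P \<Longrightarrow> lift A (\<lambda>i\<in>I. \<epsilon>\<^bsub>T i\<^esub> (A i)) = \<epsilon>\<^bsub>S\<^esub> (ObMap H A)"
  by (simp add: lift_def law_counit)

text \<open>Preservation of Kleisli composition: the tuple on the right is the componentwise Kleisli
  composite. Moving \<kappa> to the right past \<open>f\<close> and past the comultiplication leaves
  an \<open>H\<close>-image composed with \<open>\<kappa> A\<close>.\<close>

lemma lift_coextend:
  assumes A: "A \<in> Ob P" and f: "f \<in> Hom P (ObMap PT A) B" and g: "g \<in> Hom P (ObMap PT B) E"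
  shows "lift B g \<cdot>\<^bsub>D\<^esub> coextend D S (ObMap H A) (lift A f)
    = lift A (\<lambda>i\<in>I. g i \<cdot>\<^bsub>C i\<^esub> coextend (C i) (T i) (A i) (f i))"
proof -
  let ?S = "ArMap (Fun S)" and ?H = "ArMap H"
  let ?\<delta> = "\<lambda>i\<in>I. \<delta>\<^bsub>T i\<^esub> (A i)" and ?d = "\<delta>\<^bsub>S\<^esub> (ObMap H A)"
  have B: "B \<in> Ob P" using f F.C.Cod_in_Ob by (auto simp: Hom_def)
  note dA = comult_tuple_in_Hom[OF A] and kA = law_in_Hom[OF A] and kB = law_in_Hom[OF B]
  note kTA = law_in_Hom[OF PT.ObMap_in_Ob[OF A]]
  note d = S.comult_in_Hom[OF H.ObMap_in_Ob[OF A]]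
  note Tf = PT.ArMap_in_Hom[OF f]
  note Hf = H.ArMap_in_Hom[OF f] and Hg = H.ArMap_in_Hom[OF g]
  note HTf = H.ArMap_in_Hom[OF Tf] and Hd = H.ArMap_in_Hom[OF dA]
  note SHf = S.T.ArMap_in_Hom[OF Hf] and Sk = S.T.ArMap_in_Hom[OF kA]
  note Skd = F.D.Comp_in_Hom[OF d Sk]
  \<comment> \<open>\<open>law_comult\<close> associates to the left; this bracketing isolates the
    coextension of \<open>\<kappa> A\<close>.\<close>
  have law: "\<kappa> (ObMap PT A) \<cdot>\<^bsub>D\<^esub> (?S (\<kappa> A) \<cdot>\<^bsub>D\<^esub> ?d) = ?H ?\<delta> \<cdot>\<^bsub>D\<^esub> \<kappa> A"
    using law_comult[OF A] F.D.Comp_assoc[OF d Sk kTA] by (simp add: prod_functor_def)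
  have "lift B g \<cdot>\<^bsub>D\<^esub> coextend D S (ObMap H A) (lift A f)
      = (?H g \<cdot>\<^bsub>D\<^esub> \<kappa> B) \<cdot>\<^bsub>D\<^esub> (?S (?H f) \<cdot>\<^bsub>D\<^esub> (?S (\<kappa> A) \<cdot>\<^bsub>D\<^esub> ?d))"
    using S.T.ArMap_Comp[OF kA Hf] F.D.Comp_assoc[OF d Sk SHf]
    by (simp add: lift_def coextend_def)
  also have "\<dots> = ?H g \<cdot>\<^bsub>D\<^esub> ((\<kappa> B \<cdot>\<^bsub>D\<^esub> ?S (?H f)) \<cdot>\<^bsub>D\<^esub> (?S (\<kappa> A) \<cdot>\<^bsub>D\<^esub> ?d))"
    using F.D.Comp_assoc[OF F.D.Comp_in_Hom[OF Skd SHf] kB Hg] F.D.Comp_assoc[OF Skd SHf kB] by simp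
  \<comment> \<open>Naturality of \<kappa> at \<open>f\<close> creates the factor
    \<open>\<kappa> (ObMap PT A)\<close>, to which \<open>law\<close> then applies.\<close>
  also have "\<dots> = ?H g \<cdot>\<^bsub>D\<^esub> (?H (ArMap PT f) \<cdot>\<^bsub>D\<^esub> (?H ?\<delta> \<cdot>\<^bsub>D\<^esub> \<kappa> A))"
    using F.D.Comp_assoc[OF Skd kTA HTf] by (simp add: law_naturality[OF f] law)
  \<comment> \<open>Functoriality of \<open>H\<close> merges its three images into one.\<close>
  also have "\<dots> = ?H (g \<cdot>\<^bsub>P\<^esub> (ArMap PT f \<cdot>\<^bsub>P\<^esub> ?\<delta>)) \<cdot>\<^bsub>D\<^esub> \<kappa> A"
    using F.D.Comp_assoc[OF kA Hd HTf] F.D.Comp_assoc[OF kA F.D.Comp_in_Hom[OF Hd HTf] Hg]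
      H.ArMap_Comp[OF dA Tf] H.ArMap_Comp[OF F.C.Comp_in_Hom[OF dA Tf] g] by simp
  also have "g \<cdot>\<^bsub>P\<^esub> (ArMap PT f \<cdot>\<^bsub>P\<^esub> ?\<delta>)
      = (\<lambda>i\<in>I. g i \<cdot>\<^bsub>C i\<^esub> coextend (C i) (T i) (A i) (f i))"
    by (auto simp: prod_category_simps prod_functor_def coextend_def intro!: restrict_ext)
  finally show ?thesis by (simp only: lift_def)
qed

lemma kleisli_isomorphic_ObMap:
  assumes A: "A \<in> Ob P" and B: "B \<in> Ob P"
    and iso: "\<And>i. i \<in> I \<Longrightarrow> kleisli_isomorphic (C i) (T i) (A i) (B i)"
  shows "kleisli_isomorphic D S (ObMap H A) (ObMap H B)"
proof -
  \<comment> \<open>Removing the source tags from the Kleisli arrows leaves inverse pairs in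
    \<open>C i\<close>, ready for a choice over \<open>i\<close>.\<close>
  have "\<exists>f g. f \<in> Hom (C i) (ObMap (Fun (T i)) (A i)) (B i) \<and>
      g \<in> Hom (C i) (ObMap (Fun (T i)) (B i)) (A i) \<and>
      g \<cdot>\<^bsub>C i\<^esub> coextend (C i) (T i) (A i) f = \<epsilon>\<^bsub>T i\<^esub> (A i) \<and>
      f \<cdot>\<^bsub>C i\<^esub> coextend (C i) (T i) (B i) g = \<epsilon>\<^bsub>T i\<^esub> (B i)" if "i \<in> I" for i
    using iso[OF that]
    by (fastforce simp: kleisli_isomorphic_def isomorphic_def Hom_kleisli_category
        kleisli_category_simps coextend_def)
  then obtain f g where fg: "\<And>i. i \<in> I \<Longrightarrow> f i \<in> Hom (C i) (ObMap (Fun (T i)) (A i)) (B i) \<and>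
      g i \<in> Hom (C i) (ObMap (Fun (T i)) (B i)) (A i) \<and>
      g i \<cdot>\<^bsub>C i\<^esub> coextend (C i) (T i) (A i) (f i) = \<epsilon>\<^bsub>T i\<^esub> (A i) \<and>
      f i \<cdot>\<^bsub>C i\<^esub> coextend (C i) (T i) (B i) (g i) = \<epsilon>\<^bsub>T i\<^esub> (B i)"
    by metis
  \<comment> \<open>The chosen families are arbitrary outside \<open>I\<close>, whereas arrows of
    \<open>P\<close> must be \<open>undefined\<close> there.\<close>
  define F G where "F = restrict f I" and "G = restrict g I"
  have F: "F \<in> Hom P (ObMap PT A) B" and G: "G \<in> Hom P (ObMap PT B) A"
    using A B fg
    by (auto simp: F_def G_def Hom_prod_category prod_category_simps prod_functor_def PiE_iff)
  have "(\<lambda>i\<in>I. G i \<cdot>\<^bsub>C i\<^esub> coextend (C i) (T i) (A i) (F i)) = (\<lambda>i\<in>I. \<epsilon>\<^bsub>T i\<^esub> (A i))"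
    and "(\<lambda>i\<in>I. F i \<cdot>\<^bsub>C i\<^esub> coextend (C i) (T i) (B i) (G i)) = (\<lambda>i\<in>I. \<epsilon>\<^bsub>T i\<^esub> (B i))"
    using fg by (auto simp: F_def G_def intro!: restrict_ext)
  \<comment> \<open>By \<open>lift_coextend\<close> each composite is the lift of a tuple of
    counits, hence a counit of \<open>S\<close>, which is an identity in the Kleisli
    category.\<close>
  then have "lift B G \<cdot>\<^bsub>D\<^esub> coextend D S (ObMap H A) (lift A F) = \<epsilon>\<^bsub>S\<^esub> (ObMap H A)"
    and "lift A F \<cdot>\<^bsub>D\<^esub> coextend D S (ObMap H B) (lift B G) = \<epsilon>\<^bsub>S\<^esub> (ObMap H B)"
    by (simp_all add: lift_coextend[OF A F G] lift_coextend[OF B G F] lift_counit A B)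
  then show ?thesis
    using lift_in_Hom[OF A F] lift_in_Hom[OF B G] H.ObMap_in_Ob[OF A] H.ObMap_in_Ob[OF B]
    unfolding kleisli_isomorphic_def isomorphic_def
    \<comment> \<open>The lifts, tagged again with their sources, are the mutually inverse Kleisli
      arrows.\<close>
    by (intro conjI bexI[of _ "(ObMap H A, lift A F)"] bexI[of _ "(ObMap H B, lift B G)"])
      (auto simp: Hom_kleisli_category kleisli_category_simps coextend_def)
qed

end

theorem theorem3:
  fixes n :: nat
    and C :: "nat \<Rightarrow> ('o, 'm) category"
    and T :: "nat \<Rightarrow> ('o, 'm) comonad"
    and D :: "('p, 'q) category"
    and S :: "('p, 'q) comonad"
    and H :: "(nat \<Rightarrow> 'o, nat \<Rightarrow> 'm, 'p, 'q) cat_functor"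
  assumes "\<And>i. i \<in> {1..n} \<Longrightarrow> comonad (C i) (T i)"
    and "comonad D S"
    and "cat_functor (prod_category {1..n} C) D H"
    and "\<exists>\<kappa>. kleisli_law {1..n} C T D S H \<kappa>"
  shows "\<forall>A \<in> Ob (prod_category {1..n} C). \<forall>B \<in> Ob (prod_category {1..n} C).
    (\<forall>i \<in> {1..n}. kleisli_isomorphic (C i) (T i) (A i) (B i))
      \<longrightarrow> kleisli_isomorphic D S (ObMap H A) (ObMap H B)"
proof -
  obtain \<kappa> where "kleisli_law {1..n} C T D S H \<kappa>"
    using assms(4) by blast
  then interpret comonads_kleisli_law "{1..n}" C T D S H \<kappa>
    using assms(1-3)
    by (simp add: comonads_kleisli_law_def comonads_kleisli_law_axioms_def)
  show ?thesis
    using kleisli_isomorphic_ObMap by blast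
qed

end
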